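(* Let $n,m\ge 1$ and consider a system of $m$ linear ordinary differential equations of order $n$, $$\mathbf y^{(n)}+A_{n-1}(x)\,\mathbf y^{(n-1)}+\dots+A_1(x)\,\mathbf y'+A_0(x)\,\mathbf y=\mathbf b(x),\qquad \mathbf y=(y_1,\dots,y_m)\in\mathbb R^m,$$ where the $A_j(x)$ are $m\times m$ real matrix-valued functions and $\mathbf b(x)$ is an $\mathbb R^m$-valued function. The non-Cartan property of a symmetry of this system is coordinate-free, in the following sense. For every invertible change of variables from $(x,\mathbf y)$ to $(z,\mathbf w)$ of the form $$x=f(z),\qquad \mathbf y=Q(z)\,\mathbf w+\mathbf s(z),\qquad \mathbf w=(w_1,\dots,w_m)\in\mathbb R^m,$$ where $f$ is an invertible smooth function with smooth inverse, $Q(z)$ is an invertible $m\times m$ matrix depending smoothly on $z$, and $\mathbf s(z)\in\mathbb R^m$ is a particular solution of the system (expressed in terms of $z$ through $x=f(z)$), a symmetry generator of the system is non-Cartan in the coordinates $(x,\mathbf y)$ if and only if it is non-Cartan in the coordinates $(z,\mathbf w)$.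
   Context: All functions are assumed smooth on suitable open domains. A (Lie point) symmetry generator of a system $\Delta=(\Delta_1,\dots,\Delta_m)=0$ of order $n$ is a smooth vector field $$\mathbf v=\xi(x,\mathbf y)\,\frac{\partial}{\partial x}+\sum_{j=1}^m\phi_j(x,\mathbf y)\,\frac{\partial}{\partial y_j}$$ satisfying $\mathbf v^{(n)}(\Delta_\nu)\big|_{\Delta=0}=0$ for all $\nu$, where $\mathbf v^{(n)}$ is the $n$th prolongation of $\mathbf v$. It is non-Cartan in the coordinates $(x,\mathbf y)$ if $\xi$ depends explicitly on at least one of the dependent variables $y_j$ (some $\partial\xi/\partial y_j$ is not identically zero). Likewise, writing the same vector field in the new coordinates as $\mathbf v=\bar\xi(z,\mathbf w)\,\frac{\partial}{\partial z}+\sum_{j=1}^m\bar\phi_j(z,\mathbf w)\,\frac{\partial}{\partial w_j}$, it is non-Cartan in the coordinates $(z,\mathbf w)$ if $\bar\xi$ depends explicitly on at least one of the $w_j$. *)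

theory Defs
  imports "HOL-Analysis.Analysis"
begin

text \<open>Smoothness is meant on open sets only: all derivatives are taken in the full space.\<close>

primrec Ck_on :: "nat \<Rightarrow> 'a::real_normed_vector set \<Rightarrow> ('a \<Rightarrow> 'b::real_normed_vector) \<Rightarrow> bool" where
  "Ck_on 0 S f \<longleftrightarrow> continuous_on S f"
| "Ck_on (Suc k) S f \<longleftrightarrow>
     (\<forall>x\<in>S. f differentiable (at x)) \<and> (\<forall>v. Ck_on k S (\<lambda>x. frechet_derivative f (at x) v))"

definition smooth_on :: "'a::real_normed_vector set \<Rightarrow> ('a \<Rightarrow> 'b::real_normed_vector) \<Rightarrow> bool" where
  "smooth_on S f \<longleftrightarrow> (\<forall>k. Ck_on k S f)"

text \<open>
  A point of the jet space is given by x and a sequence u of vectors, where u i stands for the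
  i-th derivative of y (so u 0 is y itself). A function on the k-th jet space is a function of
  x and u that depends on u 0, ..., u k only.
\<close>

type_synonym 'm jet_fun = "real \<Rightarrow> (nat \<Rightarrow> real ^ 'm) \<Rightarrow> real"

definition jet_dx :: "('m::finite) jet_fun \<Rightarrow> 'm jet_fun" where
  "jet_dx F x u = deriv (\<lambda>t. F t u) x"

definition jet_du :: "nat \<Rightarrow> 'm \<Rightarrow> ('m::finite) jet_fun \<Rightarrow> 'm jet_fun" where
  "jet_du i j F x u = deriv (\<lambda>t. F x (u(i := u i + t *\<^sub>R axis j 1))) 0"

text \<open>Total derivative with respect to x of a function on the k-th jet space.\<close>

definition total_deriv :: "nat \<Rightarrow> ('m::finite) jet_fun \<Rightarrow> 'm jet_fun" where
  "total_deriv k F x u =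
     jet_dx F x u + (\<Sum>i\<le>k. \<Sum>j\<in>UNIV. u (Suc i) $ j * jet_du i j F x u)"

text \<open>
  A vector field on the space of pairs (x, y) is represented by its pair of components:
  the coefficient of the x-derivative, and the vector of the coefficients of the
  derivatives with respect to the components of y.
\<close>

type_synonym 'm vfield = "real \<times> (real ^ 'm) \<Rightarrow> real \<times> (real ^ 'm)"

definition vf_xi :: "('m::finite) vfield \<Rightarrow> 'm jet_fun" where
  "vf_xi V x u = fst (V (x, u 0))"

text \<open>
  Coefficient of the derivative with respect to the j-th component of u k in the prolongation
  of V, by the usual recursion
  phi(k+1) = D phi(k) - u(k+1) D xi, where D is the total derivative.
\<close>

primrec prolong_coeff :: "('m::finite) vfield \<Rightarrow> nat \<Rightarrow> 'm \<Rightarrow> 'm jet_fun" where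
  "prolong_coeff V 0 j = (\<lambda>x u. snd (V (x, u 0)) $ j)"
| "prolong_coeff V (Suc k) j = (\<lambda>x u.
     total_deriv k (prolong_coeff V k j) x u - u (Suc k) $ j * total_deriv 0 (vf_xi V) x u)"

definition prolongation :: "nat \<Rightarrow> ('m::finite) vfield \<Rightarrow> 'm jet_fun \<Rightarrow> 'm jet_fun" where
  "prolongation n V F x u =
     vf_xi V x u * jet_dx F x u
     + (\<Sum>i\<le>n. \<Sum>j\<in>UNIV. prolong_coeff V i j x u * jet_du i j F x u)"

text \<open>
  Systems of order n are given by their left-hand side \<Delta>; the vector field V lives
  on the open set M of pairs (x, y).
\<close>

definition symmetry_generator ::
  "nat \<Rightarrow> (real \<Rightarrow> (nat \<Rightarrow> real ^ 'm) \<Rightarrow> real ^ 'm) \<Rightarrow> (real \<times> (real ^ 'm)) set \<Rightarrow> ('m::finite) vfield \<Rightarrow> bool"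
  where
  "symmetry_generator n \<Delta> M V \<longleftrightarrow>
     smooth_on M V \<and>
     (\<forall>x u. (x, u 0) \<in> M \<longrightarrow> \<Delta> x u = 0 \<longrightarrow>
        (\<forall>\<nu>. prolongation n V (\<lambda>x' u'. \<Delta> x' u' $ \<nu>) x u = 0))"

definition linear_system ::
  "nat \<Rightarrow> (nat \<Rightarrow> real \<Rightarrow> real ^ 'm ^ 'm) \<Rightarrow> (real \<Rightarrow> real ^ 'm) \<Rightarrow>
   real \<Rightarrow> (nat \<Rightarrow> real ^ 'm) \<Rightarrow> real ^ ('m::finite)" where
  "linear_system n A b x u = u n + (\<Sum>k<n. A k x *v u k) - b x"

definition is_solution ::
  "(real \<Rightarrow> (nat \<Rightarrow> real ^ 'm) \<Rightarrow> real ^ 'm) \<Rightarrow> real set \<Rightarrow> (real \<Rightarrow> real ^ ('m::finite)) \<Rightarrow> bool"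
  where
  "is_solution \<Delta> I y \<longleftrightarrow>
     smooth_on I y \<and>
     (\<forall>x\<in>I. \<Delta> x (\<lambda>k. ((\<lambda>h t. vector_derivative h (at t)) ^^ k) y x) = 0)"

definition noncartan :: "(real \<times> (real ^ 'm)) set \<Rightarrow> ('m::finite) vfield \<Rightarrow> bool" where
  "noncartan M V \<longleftrightarrow>
     (\<exists>(x, y)\<in>M. \<exists>j. deriv (\<lambda>t. fst (V (x, y + t *\<^sub>R axis j 1))) 0 \<noteq> 0)"

definition coord_map ::
  "(real \<Rightarrow> real) \<Rightarrow> (real \<Rightarrow> real ^ 'm ^ 'm) \<Rightarrow> (real \<Rightarrow> real ^ 'm) \<Rightarrow>
   real \<times> (real ^ 'm) \<Rightarrow> real \<times> (real ^ ('m::finite))" where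
  "coord_map f Q s = (\<lambda>(z, w). (f z, Q z *v w + s z))"

text \<open>
  If \<Phi> maps the new coordinates of a point to its old coordinates, the components of V in the
  new coordinates are obtained by applying the inverse of the differential of \<Phi>.
\<close>

definition vf_in_new_coords ::
  "(real \<times> (real ^ 'm) \<Rightarrow> real \<times> (real ^ 'm)) \<Rightarrow> ('m::finite) vfield \<Rightarrow> 'm vfield" where
  "vf_in_new_coords \<Phi> V q = inv (frechet_derivative \<Phi> (at q)) (V (\<Phi> q))"

end

theory Submission
  imports Defs
begin

text \<open>
  The z-component of the transformed field is \<open>\<xi>(f z, Q z w + s z) / f' z\<close>. Its gradient in w
  is therefore the gradient of \<open>\<xi>\<close> in y multiplied by \<open>Q z / f' z\<close>, which is invertible, so that one
  gradient vanishes if and only if the other does.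
\<close>

lemma smooth_on_imp_differentiable:
  assumes "smooth_on S f" and "x \<in> S"
  shows "f differentiable (at x)"
proof -
  have "Ck_on (Suc 0) S f"
    using assms(1) unfolding smooth_on_def by blast
  then show ?thesis
    using assms(2) by simp
qed

text \<open>By the chain rule a zero of \<open>deriv f\<close> at \<open>z\<close> would give
  \<open>g \<circ> f\<close> derivative 0 there, while this composition agrees with the identity on
  the open set \<open>J\<close>.\<close>

lemma deriv_inverse_nonzero:
  fixes f g :: "real \<Rightarrow> real"
  assumes "open J" and "z \<in> J" and "\<And>t. t \<in> J \<Longrightarrow> g (f t) = t"
    and "f differentiable (at z)" and "g differentiable (at (f z))"
  shows "deriv f z \<noteq> 0"
proof
  assume *: "deriv f z = 0"
  have f: "(f has_field_derivative deriv f z) (at z)"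
    using assms(4) by (simp add: DERIV_deriv_iff_real_differentiable)
  have g: "(g has_field_derivative deriv g (f z)) (at (f z))"
    using assms(5) by (simp add: DERIV_deriv_iff_real_differentiable)
  have "((\<lambda>t. g (f t)) has_field_derivative deriv g (f z) * deriv f z) (at z)"
    using DERIV_chain2[OF g f] .
  then have "((\<lambda>t. t) has_field_derivative 0) (at z)"
    using has_field_derivative_transform_within_open[OF _ assms(1,2,3)] * by simp
  then show False
    using DERIV_unique[OF _ DERIV_ident] by fastforce
qed

lemma linear_zero_on_axes_iff:
  fixes L :: "real ^ ('m::finite) \<Rightarrow> real"
  assumes "linear L"
  shows "(\<forall>j. L (axis j 1) = 0) \<longleftrightarrow> (\<forall>v. L v = 0)"
proof
  assume "\<forall>j. L (axis j 1) = 0"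
  then have "L v = 0" if "v \<in> Basis" for v
    using that by (auto simp: Basis_vec_def)
  then show "\<forall>v. L v = 0"
    using linear_eq_stdbasis[OF assms linear_zero] by metis
qed blast

text \<open>The vectors \<open>P *v axis j 1\<close> are in general not axes, so both sides are
  first extended to all vectors by linearity. There surjectivity of \<open>P\<close> makes the two
  conditions agree.\<close>

lemma linear_comp_invertible_zero_on_axes_iff:
  fixes L :: "real ^ ('m::finite) \<Rightarrow> real"
  assumes "linear L" and "invertible P"
  shows "(\<forall>j. L (P *v axis j 1) = 0) \<longleftrightarrow> (\<forall>j. L (axis j 1) = 0)"
proof -
  have "linear (\<lambda>v. L (P *v v))"
    using linear_compose[OF matrix_vector_mul_linear assms(1), of P] by (simp add: o_def)
  then have "(\<forall>j. L (P *v axis j 1) = 0) \<longleftrightarrow> (\<forall>v. L (P *v v) = 0)"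
    using linear_zero_on_axes_iff by blast
  also have "\<dots> \<longleftrightarrow> (\<forall>v. L v = 0)"
    using assms(2) by (metis invertible_def matrix_vector_mul_assoc matrix_vector_mul_lid)
  also have "\<dots> \<longleftrightarrow> (\<forall>j. L (axis j 1) = 0)"
    using linear_zero_on_axes_iff[OF assms(1)] by simp
  finally show ?thesis .
qed

text \<open>This provides the product rule for \<open>Q z *v w\<close>, where both factors
  vary.\<close>

lemma bounded_bilinear_matrix_vector_mult:
  "bounded_bilinear ((*v) :: real ^ 'n ^ 'm \<Rightarrow> real ^ ('n::finite) \<Rightarrow> real ^ ('m::finite))"
proof -
  have "bilinear ((*v) :: real ^ 'n ^ 'm \<Rightarrow> real ^ 'n \<Rightarrow> real ^ 'm)"
    unfolding bilinear_def
    by (auto intro!: linearI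
        simp: matrix_vector_right_distrib matrix_vector_mult_add_rdistrib
          matrix_vector_mult_scaleR scaleR_matrix_vector_assoc)
  then show ?thesis
    by (simp add: bilinear_conv_bounded_bilinear)
qed

text \<open>The differential is block triangular because the new x depends on z alone. The
  off-diagonal column \<open>p\<close> equals Q'(z) w + s'(z); it stays existential since later
  arguments use only the triangular shape.\<close>

lemma coord_map_frechet_derivative:
  assumes "f differentiable (at z)" and "Q differentiable (at z)" and "s differentiable (at z)"
  shows "\<exists>p. frechet_derivative (coord_map f Q s) (at (z, w)) =
             (\<lambda>(a, c). (deriv f z * a, a *\<^sub>R p + Q z *v c))"
proof -
  let ?Q' = "vector_derivative Q (at z)" and ?s' = "vector_derivative s (at z)"
  have f: "((\<lambda>q. f (fst q)) has_derivative (\<lambda>q. deriv f z * fst q)) (at (z, w))"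
    using has_derivative_compose[OF has_derivative_fst[OF has_derivative_ident], of f "\<lambda>a. deriv f z * a" "(z, w)"]
      assms(1)
    by (simp add: DERIV_deriv_iff_real_differentiable[symmetric] has_field_derivative_def)
  have Q: "((\<lambda>q. Q (fst q)) has_derivative (\<lambda>q. fst q *\<^sub>R ?Q')) (at (z, w))"
    using has_derivative_compose[OF has_derivative_fst[OF has_derivative_ident], of Q "\<lambda>a. a *\<^sub>R ?Q'" "(z, w)"]
      assms(2)
    by (simp add: vector_derivative_works has_vector_derivative_def)
  have s: "((\<lambda>q. s (fst q)) has_derivative (\<lambda>q. fst q *\<^sub>R ?s')) (at (z, w))"
    using has_derivative_compose[OF has_derivative_fst[OF has_derivative_ident], of s "\<lambda>a. a *\<^sub>R ?s'" "(z, w)"]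
      assms(3)
    by (simp add: vector_derivative_works has_vector_derivative_def)
  have "((\<lambda>q. (f (fst q), Q (fst q) *v snd q + s (fst q))) has_derivative
      (\<lambda>q. (deriv f z * fst q, (Q (fst (z, w)) *v snd q + (fst q *\<^sub>R ?Q') *v snd (z, w)) + fst q *\<^sub>R ?s')))
      (at (z, w))"
    by (intro has_derivative_Pair has_derivative_add f s
        bounded_bilinear.FDERIV[OF bounded_bilinear_matrix_vector_mult]
        Q has_derivative_snd has_derivative_ident)
  then have "(coord_map f Q s has_derivative
      (\<lambda>(a, c). (deriv f z * a, a *\<^sub>R (?Q' *v w + ?s') + Q z *v c))) (at (z, w))"
    by (simp add: coord_map_def case_prod_unfold scaleR_right_distrib scaleR_matrix_vector_assoc
        ac_simps)
  then show ?thesis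
    by (intro exI) (rule frechet_derivative_at[symmetric])
qed

lemma fst_vf_in_new_coords:
  assumes "f differentiable (at z)" and "Q differentiable (at z)" and "s differentiable (at z)"
    and "deriv f z \<noteq> 0" and "invertible (Q z)"
  shows "fst (vf_in_new_coords (coord_map f Q s) V (z, w)) =
         fst (V (f z, Q z *v w + s z)) / deriv f z"
proof -
  let ?D = "frechet_derivative (coord_map f Q s) (at (z, w))"
  obtain p where D: "?D = (\<lambda>(a, c). (deriv f z * a, a *\<^sub>R p + Q z *v c))"
    using coord_map_frechet_derivative[OF assms(1-3)] by blast
  obtain R where R: "Q z ** R = mat 1"
    using assms(5) unfolding invertible_def by blast
  let ?v = "V (f z, Q z *v w + s z)"
  let ?a = "fst ?v / deriv f z"
  \<comment> \<open>A preimage of \<open>?v\<close> found by solving the triangular system: the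
    first row gives \<open>?a\<close>, then the right inverse \<open>R\<close> of \<open>Q z\<close>
    solves the second.\<close>
  have "?D (?a, R *v (snd ?v - ?a *\<^sub>R p)) = ?v"
    using assms(4) R by (simp add: D matrix_vector_mul_assoc)
  \<comment> \<open>\<open>inv\<close> chooses some preimage, and one exists by the previous step.
    The first row of \<open>?D\<close> then fixes the first component of whichever preimage is
    chosen.\<close>
  then have "?D (inv ?D ?v) = ?v"
    by (metis f_inv_into_f rangeI)
  then have "deriv f z * fst (inv ?D ?v) = fst ?v"
    by (simp add: D case_prod_unfold prod_eq_iff)
  then show ?thesis
    using assms(4) by (simp add: vf_in_new_coords_def coord_map_def field_simps)
qed

text \<open>This turns the partial derivatives in \<open>noncartan\<close> into values of a map
  linear in the direction. The direction \<open>v\<close> is arbitrary because \<open>Q z\<close>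
  sends axes to general vectors.\<close>

lemma has_field_derivative_fst_along_line:
  assumes "V differentiable (at (x, y))"
  shows "((\<lambda>t. fst (V (x, y + t *\<^sub>R v))) has_field_derivative
          fst (frechet_derivative V (at (x, y)) (0, v))) (at 0)"
proof -
  let ?D = "frechet_derivative V (at (x, y))"
  have V: "(V has_derivative ?D) (at (x, y + 0 *\<^sub>R v))"
    using assms by (simp add: frechet_derivative_works)
  have l: "((\<lambda>t. (x, y + t *\<^sub>R v)) has_derivative (\<lambda>t. (0, t *\<^sub>R v))) (at 0)"
    by (auto intro!: derivative_eq_intros)
  have "((\<lambda>t. fst (V (x, y + t *\<^sub>R v))) has_derivative (\<lambda>t. fst (?D (0, t *\<^sub>R v)))) (at 0)"
    by (rule has_derivative_fst has_derivative_compose[OF l V])+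
  \<comment> \<open>Homogeneity turns the linear map in \<open>t\<close> into multiplication by a
    number, the form that \<open>has_field_derivative\<close> requires.\<close>
  moreover have "?D (0, t *\<^sub>R v) = t *\<^sub>R ?D (0, v)" for t
    using linear_scale[OF linear_frechet_derivative[OF assms], of t "(0, v)"] by simp
  ultimately show ?thesis
    by (simp add: has_field_derivative_def mult_commute_abs)
qed

lemma noncartan_iff:
  "noncartan M V \<longleftrightarrow>
     (\<exists>x y. (x, y) \<in> M \<and> (\<exists>j. deriv (\<lambda>t. fst (V (x, y + t *\<^sub>R axis j 1))) 0 \<noteq> 0))"
  unfolding noncartan_def Bex_def split_paired_Ex by simp

theorem lemma3:
  fixes n :: nat
    and A :: "nat \<Rightarrow> real \<Rightarrow> real ^ 'm ^ ('m::finite)"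
    and b :: "real \<Rightarrow> real ^ 'm"
    and I J :: "real set"
    and f :: "real \<Rightarrow> real"
    and Q :: "real \<Rightarrow> real ^ 'm ^ 'm"
    and s :: "real \<Rightarrow> real ^ 'm"
    and M :: "(real \<times> (real ^ 'm)) set"
    and V :: "'m vfield"
  assumes "n \<ge> 1"
    and "open I" and "open J"
    and "\<And>k. k < n \<Longrightarrow> smooth_on I (A k)" and "smooth_on I b"
    and "bij_betw f J I" and "smooth_on J f" and "smooth_on I (inv_into J f)"
    and "smooth_on J Q" and "\<And>z. z \<in> J \<Longrightarrow> invertible (Q z)"
    and "smooth_on J s"
    and "is_solution (linear_system n A b) I (\<lambda>x. s (inv_into J f x))"
    and "open M" and "M \<subseteq> I \<times> UNIV"
    and "symmetry_generator n (linear_system n A b) M V"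
  shows "noncartan M V \<longleftrightarrow>
         noncartan {q \<in> J \<times> UNIV. coord_map f Q s q \<in> M} (vf_in_new_coords (coord_map f Q s) V)"
proof -
  let ?\<Phi> = "coord_map f Q s"
  let ?N = "{q \<in> J \<times> UNIV. ?\<Phi> q \<in> M}"
  let ?W = "vf_in_new_coords ?\<Phi> V"
  have smooth_V: "smooth_on M V"
    using assms(15) by (simp add: symmetry_generator_def)
  \<comment> \<open>The equivalence holds separately at each pair of corresponding points; the
    global statement then only needs these points to be matched up.\<close>
  have pointwise: "(\<exists>j. deriv (\<lambda>t. fst (?W (z, w + t *\<^sub>R axis j 1))) 0 \<noteq> 0) \<longleftrightarrow>
      (\<exists>j. deriv (\<lambda>t. fst (V (f z, Q z *v w + s z + t *\<^sub>R axis j 1))) 0 \<noteq> 0)"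
    if z: "z \<in> J" and M: "(f z, Q z *v w + s z) \<in> M" for z w
  proof -
    let ?y = "Q z *v w + s z"
    let ?L = "\<lambda>v. fst (frechet_derivative V (at (f z, ?y)) (0, v))"
    have V: "V differentiable (at (f z, ?y))"
      using smooth_on_imp_differentiable[OF smooth_V M] .
    have f: "f differentiable (at z)" and Q: "Q differentiable (at z)" and s: "s differentiable (at z)"
      using smooth_on_imp_differentiable z assms(7,9,11) by blast+
    have "f z \<in> I"
      using assms(6) z by (auto simp: bij_betw_def)
    then have "inv_into J f differentiable (at (f z))"
      using smooth_on_imp_differentiable assms(8) by blast
    then have f': "deriv f z \<noteq> 0"
      using deriv_inverse_nonzero[OF assms(3) z bij_betw_inv_into_left[OF assms(6)] f] by simp
    have lin: "linear ?L"
    proof -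
      have "linear (\<lambda>v. (0::real, v :: real ^ 'm))"
        by (rule linearI) auto
      then show ?thesis
        using linear_compose[OF linear_compose[OF _ linear_frechet_derivative[OF V]] linear_fst]
        by (simp add: o_def)
    qed
    have "deriv (\<lambda>t. fst (?W (z, w + t *\<^sub>R axis j 1))) 0 = ?L (Q z *v axis j 1) / deriv f z" for j
    proof -
      \<comment> \<open>Moving \<open>w\<close> along an axis keeps \<open>z\<close> fixed, so
        \<open>deriv f z\<close> is a constant divisor and y runs along a straight line in direction
        \<open>Q z *v axis j 1\<close>.\<close>
      have "fst (?W (z, w + t *\<^sub>R axis j 1)) =
          fst (V (f z, ?y + t *\<^sub>R (Q z *v axis j 1))) / deriv f z" for t
        by (simp add: fst_vf_in_new_coords[OF f Q s f' assms(10)[OF z]] matrix_vector_right_distrib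
            matrix_vector_mult_scaleR ac_simps)
      then show ?thesis
        using DERIV_cdivide[OF has_field_derivative_fst_along_line[OF V]]
        by (simp add: DERIV_imp_deriv)
    qed
    then show ?thesis
      \<comment> \<open>Both existential claims are negations of "the gradient vanishes on all
        axes", the form that the linear algebra lemma compares.\<close>
      using linear_comp_invertible_zero_on_axes_iff[OF lin assms(10)[OF z]] f'
      by (simp only: DERIV_imp_deriv[OF has_field_derivative_fst_along_line[OF V]]
          divide_eq_0_iff simp_thms flip: not_all)
  qed
  \<comment> \<open>Every point of \<open>M\<close> has new coordinates: \<open>z\<close> comes from
    surjectivity of \<open>f\<close> onto \<open>I\<close>, and \<open>w\<close> from solving the
    affine equation with a right inverse of \<open>Q z\<close>. This transfers a witness from the
    old coordinates to the new ones.\<close>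
  have onto: "\<exists>z w. z \<in> J \<and> x = f z \<and> y = Q z *v w + s z" if "(x, y) \<in> M" for x y
  proof -
    have "x \<in> f ` J"
      using that assms(14) bij_betw_imp_surj_on[OF assms(6)] by auto
    then obtain z where z: "z \<in> J" "x = f z"
      by blast
    obtain R where R: "Q z ** R = mat 1"
      using assms(10)[OF z(1)] unfolding invertible_def by blast
    have "y = Q z *v (R *v (y - s z)) + s z"
      using R by (simp add: matrix_vector_mul_assoc)
    with z show ?thesis
      by blast
  qed
  show ?thesis
  proof
    assume "noncartan M V"
    then obtain x y where M: "(x, y) \<in> M"
      and nz: "\<exists>j. deriv (\<lambda>t. fst (V (x, y + t *\<^sub>R axis j 1))) 0 \<noteq> 0"
      unfolding noncartan_iff by blast
    obtain z w where zw: "z \<in> J" "x = f z" "y = Q z *v w + s z"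
      using onto[OF M] by blast
    then have "(z, w) \<in> ?N"
      using M by (simp add: coord_map_def)
    moreover have "\<exists>j. deriv (\<lambda>t. fst (?W (z, w + t *\<^sub>R axis j 1))) 0 \<noteq> 0"
      using pointwise[of z w] M nz zw by blast
    ultimately show "noncartan ?N ?W"
      unfolding noncartan_iff by blast
  next
    assume "noncartan ?N ?W"
    then obtain z w where "(z, w) \<in> ?N"
      and nz: "\<exists>j. deriv (\<lambda>t. fst (?W (z, w + t *\<^sub>R axis j 1))) 0 \<noteq> 0"
      unfolding noncartan_iff by blast
    then have z: "z \<in> J" and M: "(f z, Q z *v w + s z) \<in> M"
      by (auto simp: coord_map_def)
    have "\<exists>j. deriv (\<lambda>t. fst (V (f z, Q z *v w + s z + t *\<^sub>R axis j 1))) 0 \<noteq> 0"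
      using pointwise[OF z M] nz by blast
    with M show "noncartan M V"
      unfolding noncartan_iff by blast
  qed
qed

end
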